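(* Let $\mathcal{S}^*$ be a family of switching signals which has property P, and let $\mathcal{T}^*$ be the set of all complete trajectories $(\bar x,\bar\sigma)$ of $\dot x=f(x,\sigma)$ with $\bar\sigma\in\mathcal{S}^*$. Let $(x,\sigma)$, with $\sigma\in\mathcal{S}^*$, be a forward complete trajectory of $\dot x=f(x,\sigma)$. Suppose that there exists a function $V\in\mathcal{V}$ whose restriction to $\mathrm{dom}(f)\cap(\mathcal{O}\times\Gamma)$ is continuous (where $\mathcal{O}=\pi_1(\mathrm{dom}(V))$), such that $(x,\sigma)$ is precompact relative to $\mathcal{O}$ and $v(t)=V(x(t),\sigma(t))$ is nonincreasing on $[0,+\infty)$. Then there exists $c\in\mathbb{R}$ such that $x\to\pi_1(M(c))$, where $M(c)$ is the maximal weakly-invariant set with respect to $\mathcal{T}^*$ contained in $V^{-1}(c)\cap Z_V$.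
   Context: Setting: $\Gamma$ is a compact metric space, $\mathrm{dom}(f)\subset\mathbb{R}^n\times\Gamma$ is closed and $f:\mathrm{dom}(f)\to\mathbb{R}^n$ is continuous. For $\gamma\in\Gamma$, $\chi_\gamma=\{\xi\in\mathbb{R}^n:(\xi,\gamma)\in\mathrm{dom}(f)\}$ and $f_\gamma:\chi_\gamma\to\mathbb{R}^n$, $f_\gamma(\xi)=f(\xi,\gamma)$. A switching signal is a function $\sigma:\mathbb{R}\to\Gamma$ that is piecewise constant (at most finitely many jumps in each compact interval) and continuous from the right; $\Lambda(\sigma)$ is the set of times at which $\sigma$ has a jump. A solution of $\dot x=f(x,\sigma)$ corresponding to $\sigma$ is a locally absolutely continuous $x:I_x\to\mathbb{R}^n$, $I_x\subset\mathbb{R}$ a nonempty interval, with $(x(t),\sigma(t))\in\mathrm{dom}(f)$ for all $t\in I_x$ and $\dot x(t)=f(x(t),\sigma(t))$ for almost all $t\in I_x$. Then $(x,\sigma)$ is called a trajectory; it is complete if $I_x=\mathbb{R}$ and forward complete if $\mathbb{R}_{\ge0}\subset I_x$. It is precompact relative to $\mathcal{O}\subset\mathbb{R}^n$ if there is a compact set $B\subset\mathcal{O}$ with $x(t)\in B$ for all $t\in I_x$. For $\tau_D>0$ and $N_0\in\mathbb{N}$, $\mathcal{S}_a[\tau_D,N_0]$ is the set of switching signals $\sigma$ with $\mathrm{card}(\Lambda(\sigma)\cap(\tau_1,\tau_2))\le N_0+(\tau_2-\tau_1)/\tau_D$ for every finite open interval $(\tau_1,\tau_2)$. A family $\mathcal{S}^*$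 of switching signals has property P if: (1) $\mathcal{S}^*\subset\mathcal{S}_a[\tau_D,N_0]$ for some $\tau_D>0$, $N_0\in\mathbb{N}$; (2) for any $s>0$ and any $\sigma\in\mathcal{S}^*$, $\sigma(\cdot+s)\in\mathcal{S}^*$; (3) for every sequence $\{\sigma_k\}\subset\mathcal{S}^*$ there exist $\sigma^*\in\mathcal{S}^*$ and a subsequence $\{\sigma_{k_l}\}$ with $\lim_{l\to\infty}\sigma_{k_l}(t)=\sigma^*(t)$ for almost all $t\in\mathbb{R}$. Weak invariance: given a family $\mathcal{T}^*$ of complete trajectories, a nonempty set $M\subset\mathbb{R}^n\times\Gamma$ is weakly-invariant with respect to $\mathcal{T}^*$ if for each $(\xi,\gamma)\in M$ there is $(x,\sigma)\in\mathcal{T}^*$ with $x(0)=\xi$, $\sigma(0)=\gamma$ and $(x(t),\sigma(t))\in M$ for all $t\in\mathbb{R}$. "Maximal" is with respect to inclusion. $\pi_1:\mathbb{R}^n\times\Gamma\to\mathbb{R}^n$ is the projection onto the first component. For $M\subset\mathbb{R}^n$, $x\to M$ means $\lim_{t\to+\infty}d(x(t),M)=0$, where $d(\xi,M)=\inf_{\nu\in M}|\nu-\xi|$. Class $\mathcal{V}$: $V:\mathrm{dom}(V)\to\mathbb{R}$ belongs to $\mathcal{V}$ if $\mathrm{dom}(V)\subset\mathbb{R}^n\times\Gamma$; for every $\gamma\in\Gamma$ the set $\mathcal{D}_\gamma=\{\xi:(\xi,\gamma)\in\mathrm{dom}(V)\}$ is open; with $\mathcal{O}=\pi_1(\mathrm{dom}(V))$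 and $\mathcal{O}_\gamma=\mathcal{O}\cap\chi_\gamma$, one has $\mathcal{O}_\gamma\subset\mathcal{D}_\gamma$ for all $\gamma$; and for all $\gamma$, $V_\gamma(\cdot)=V(\cdot,\gamma)$ is differentiable on $\mathcal{O}_\gamma$. For $V\in\mathcal{V}$, $Z_V=\{(\xi,\gamma)\in\mathrm{dom}(f)\cap(\mathcal{O}\times\Gamma):\nabla V_\gamma(\xi)f_\gamma(\xi)=0\}$. *)

theory Defs
  imports "HOL-Analysis.Analysis"
begin

text \<open>
  The compact metric space \<open>\<Gamma>\<close> is a type \<open>'g :: metric_space\<close>
  with \<open>compact (UNIV :: 'g set)\<close>. A function with a domain is a total function together with
  a set: \<open>(F, f)\<close> for the right-hand side \<open>f\<close> with \<open>F = dom(f)\<close>,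
  \<open>(W, V)\<close> for \<open>V\<close> with \<open>W = dom(V)\<close>, \<open>(I, x)\<close> for a solution
  \<open>x\<close> on \<open>I\<close>. No definition depends on values outside the domain.
\<close>

definition fibre :: "('a \<times> 'g) set \<Rightarrow> 'g \<Rightarrow> 'a set" where
  "fibre D \<gamma> = {\<xi>. (\<xi>, \<gamma>) \<in> D}"


subsection \<open>Switching signals\<close>

definition jumps :: "(real \<Rightarrow> 'g::metric_space) \<Rightarrow> real set" where
  "jumps \<sigma> = {t. \<not> isCont \<sigma> t}"

definition switching_signal :: "(real \<Rightarrow> 'g::metric_space) \<Rightarrow> bool" where
  "switching_signal \<sigma> \<longleftrightarrow>
     (\<forall>a b. finite (jumps \<sigma> \<inter> {a..b})) \<and>
     (\<forall>a b. jumps \<sigma> \<inter> {a<..<b} = {} \<longrightarrow> \<sigma> constant_on {a<..<b}) \<and>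
     (\<forall>t. continuous (at_right t) \<sigma>)"

definition avg_dwell :: "real \<Rightarrow> nat \<Rightarrow> (real \<Rightarrow> 'g::metric_space) set" where
  "avg_dwell \<tau>D N0 = {\<sigma>. switching_signal \<sigma> \<and>
     (\<forall>\<tau>1 \<tau>2. \<tau>1 < \<tau>2 \<longrightarrow>
        real (card (jumps \<sigma> \<inter> {\<tau>1<..<\<tau>2})) \<le> real N0 + (\<tau>2 - \<tau>1) / \<tau>D)}"

definition property_P :: "(real \<Rightarrow> 'g::metric_space) set \<Rightarrow> bool" where
  "property_P S \<longleftrightarrow>
     (\<exists>\<tau>D>0. \<exists>N0. S \<subseteq> avg_dwell \<tau>D N0) \<and>
     (\<forall>s>0. \<forall>\<sigma>\<in>S. (\<lambda>t. \<sigma> (t + s)) \<in> S) \<and>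
     (\<forall>\<sigma>s :: nat \<Rightarrow> real \<Rightarrow> 'g. (\<forall>k. \<sigma>s k \<in> S) \<longrightarrow>
        (\<exists>\<sigma>'\<in>S. \<exists>r :: nat \<Rightarrow> nat. strict_mono r \<and>
           (AE t in lebesgue. (\<lambda>l. \<sigma>s (r l) t) \<longlonglongrightarrow> \<sigma>' t)))"


subsection \<open>Trajectories\<close>

definition abs_continuous_on :: "real set \<Rightarrow> (real \<Rightarrow> 'a::real_normed_vector) \<Rightarrow> bool" where
  "abs_continuous_on S x \<longleftrightarrow>
     (\<forall>\<epsilon>>0. \<exists>\<delta>>0. \<forall>P :: (real \<times> real) set.
        finite P \<longrightarrow>
        (\<forall>(a, b)\<in>P. a \<le> b \<and> {a..b} \<subseteq> S) \<longrightarrow>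
        pairwise (\<lambda>(a, b) (c, d). {a<..<b} \<inter> {c<..<d} = {}) P \<longrightarrow>
        (\<Sum>(a, b)\<in>P. b - a) < \<delta> \<longrightarrow>
        (\<Sum>(a, b)\<in>P. norm (x b - x a)) < \<epsilon>)"

definition locally_abs_continuous_on ::
  "real set \<Rightarrow> (real \<Rightarrow> 'a::real_normed_vector) \<Rightarrow> bool" where
  "locally_abs_continuous_on I x \<longleftrightarrow> (\<forall>a b. {a..b} \<subseteq> I \<longrightarrow> abs_continuous_on {a..b} x)"

definition trajectory ::
  "((real^'n) \<times> 'g::metric_space) set \<Rightarrow> ((real^'n) \<times> 'g \<Rightarrow> real^'n) \<Rightarrow>
   real set \<Rightarrow> (real \<Rightarrow> real^'n) \<Rightarrow> (real \<Rightarrow> 'g) \<Rightarrow> bool" where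
  "trajectory F f I x \<sigma> \<longleftrightarrow>
     is_interval I \<and> I \<noteq> {} \<and>
     switching_signal \<sigma> \<and>
     locally_abs_continuous_on I x \<and>
     (\<forall>t\<in>I. (x t, \<sigma> t) \<in> F) \<and>
     (AE t in lebesgue. t \<in> I \<longrightarrow> (x has_vector_derivative f (x t, \<sigma> t)) (at t within I))"

definition forward_complete ::
  "((real^'n) \<times> 'g::metric_space) set \<Rightarrow> ((real^'n) \<times> 'g \<Rightarrow> real^'n) \<Rightarrow>
   real set \<Rightarrow> (real \<Rightarrow> real^'n) \<Rightarrow> (real \<Rightarrow> 'g) \<Rightarrow> bool" where
  "forward_complete F f I x \<sigma> \<longleftrightarrow> trajectory F f I x \<sigma> \<and> {0..} \<subseteq> I"

definition complete_trajectories ::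
  "((real^'n) \<times> 'g::metric_space) set \<Rightarrow> ((real^'n) \<times> 'g \<Rightarrow> real^'n) \<Rightarrow>
   (real \<Rightarrow> 'g) set \<Rightarrow> ((real \<Rightarrow> real^'n) \<times> (real \<Rightarrow> 'g)) set" where
  "complete_trajectories F f S = {(x, \<sigma>). trajectory F f UNIV x \<sigma> \<and> \<sigma> \<in> S}"

definition precompact_rel :: "'a::topological_space set \<Rightarrow> real set \<Rightarrow> (real \<Rightarrow> 'a) \<Rightarrow> bool" where
  "precompact_rel Q I x \<longleftrightarrow> (\<exists>B. compact B \<and> B \<subseteq> Q \<and> (\<forall>t\<in>I. x t \<in> B))"


subsection \<open>Weak invariance\<close>

definition weakly_invariant ::
  "((real \<Rightarrow> 'a) \<times> (real \<Rightarrow> 'g)) set \<Rightarrow> ('a \<times> 'g) set \<Rightarrow> bool" where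
  "weakly_invariant T M \<longleftrightarrow> M \<noteq> {} \<and>
     (\<forall>(\<xi>, \<gamma>)\<in>M. \<exists>(x, \<sigma>)\<in>T. x 0 = \<xi> \<and> \<sigma> 0 = \<gamma> \<and> (\<forall>t. (x t, \<sigma> t) \<in> M))"

definition maximal_weakly_invariant_in ::
  "((real \<Rightarrow> 'a) \<times> (real \<Rightarrow> 'g)) set \<Rightarrow> ('a \<times> 'g) set \<Rightarrow> ('a \<times> 'g) set \<Rightarrow> bool" where
  "maximal_weakly_invariant_in T E M \<longleftrightarrow>
     weakly_invariant T M \<and> M \<subseteq> E \<and>
     (\<forall>N. weakly_invariant T N \<and> N \<subseteq> E \<and> M \<subseteq> N \<longrightarrow> N = M)"


subsection \<open>Lyapunov-like functions\<close>

text \<open>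
  Differentiability is stated at \<open>\<xi>\<close> with the full neighbourhood filter: the points
  concerned lie in \<open>fibre W \<gamma>\<close>, which is open.
\<close>

definition class_V ::
  "((real^'n) \<times> 'g) set \<Rightarrow> ((real^'n) \<times> 'g) set \<Rightarrow> ((real^'n) \<times> 'g \<Rightarrow> real) \<Rightarrow> bool" where
  "class_V F W V \<longleftrightarrow>
     (\<forall>\<gamma>. open (fibre W \<gamma>)) \<and>
     (\<forall>\<gamma>. fst ` W \<inter> fibre F \<gamma> \<subseteq> fibre W \<gamma>) \<and>
     (\<forall>\<gamma>. \<forall>\<xi> \<in> fst ` W \<inter> fibre F \<gamma>. (\<lambda>\<eta>. V (\<eta>, \<gamma>)) differentiable (at \<xi>))"

definition gradient :: "('a::real_inner \<Rightarrow> real) \<Rightarrow> 'a \<Rightarrow> 'a" where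
  "gradient g \<xi> = (THE d. GDERIV g \<xi> :> d)"

definition Z_set ::
  "((real^'n) \<times> 'g) set \<Rightarrow> ((real^'n) \<times> 'g \<Rightarrow> real^'n) \<Rightarrow>
   ((real^'n) \<times> 'g) set \<Rightarrow> ((real^'n) \<times> 'g \<Rightarrow> real) \<Rightarrow> ((real^'n) \<times> 'g) set" where
  "Z_set F f W V =
     {(\<xi>, \<gamma>). (\<xi>, \<gamma>) \<in> F \<inter> (fst ` W \<times> UNIV) \<and>
        gradient (\<lambda>\<eta>. V (\<eta>, \<gamma>)) \<xi> \<bullet> f (\<xi>, \<gamma>) = 0}"

end

theory Submission
  imports Defs "HOL-Complex_Analysis.Great_Picard"
begin

text \<open>
  Along the trajectory \<open>V\<close> decreases to a limit \<open>c\<close>. For times \<open>t\<^sub>k \<rightarrow> \<infinity>\<close>, the translates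
  \<open>x(\<cdot> + t\<^sub>k)\<close> are equi-Lipschitz and take values in a compact set, and property P applies to the translates
  \<open>\<sigma>(\<cdot> + t\<^sub>k)\<close>; along a subsequence they converge, by dominated convergence in the integral form
  of the equation, to a complete trajectory \<open>(y, \<tau>)\<close> on which \<open>V = c\<close>. As \<open>\<tau>\<close> is constant just to the right of
  each time, the right derivative of \<open>V\<close> along \<open>(y, \<tau>)\<close> is \<open>\<nabla>V \<bullet> f = 0\<close>, so the orbit of \<open>(y, \<tau>)\<close> is a weakly
  invariant subset of the level set. Hence every limit point \<open>y 0\<close> of \<open>x\<close> lies in the projection of the
  union of all such subsets, which is the maximal one.
\<close>

subsection \<open>The fundamental theorem of calculus for absolutely continuous functions\<close>

text \<open>Distinct members of a tagged family have disjoint interiors, so an interval can recur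
  under two tags only if it is degenerate, and then its increment is zero. The nondegenerate ones
  form an admissible set of endpoint pairs whose total length is at most the measure of the
  union.\<close>

lemma abs_continuous_on_tagged_partial_division:
  fixes x :: "real \<Rightarrow> 'a::real_normed_vector"
  assumes "abs_continuous_on {a..b} x" and "\<epsilon> > 0"
  obtains \<delta> where "\<delta> > 0"
    and "\<And>p. p tagged_partial_division_of {a..b} \<Longrightarrow> measure lebesgue (\<Union>(snd ` p)) < \<delta> \<Longrightarrow>
               (\<Sum>(t, K)\<in>p. norm (x (Sup K) - x (Inf K))) < \<epsilon>"
proof -
  obtain \<delta> where \<delta>: "\<delta> > 0" and ac: "\<And>P. finite P \<Longrightarrow>
        (\<forall>(u, v)\<in>P. u \<le> v \<and> {u..v} \<subseteq> {a..b}) \<Longrightarrow>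
        pairwise (\<lambda>(u, v) (c, d). {u<..<v} \<inter> {c<..<d} = {}) P \<Longrightarrow>
        (\<Sum>(u, v)\<in>P. v - u) < \<delta> \<Longrightarrow> (\<Sum>(u, v)\<in>P. norm (x v - x u)) < \<epsilon>"
    using assms(1)[unfolded abs_continuous_on_def, rule_format, OF assms(2)] by (elim exE conjE) blast
  have "(\<Sum>(t, K)\<in>p. norm (x (Sup K) - x (Inf K))) < \<epsilon>"
    if p: "p tagged_partial_division_of {a..b}" and m: "measure lebesgue (\<Union>(snd ` p)) < \<delta>" for p
  proof -
    define D where "D = {K \<in> snd ` p. interior K \<noteq> {}}"
    define P where "P = (\<lambda>K. (Inf K, Sup K)) ` D"
    have div: "snd ` p division_of \<Union>(snd ` p)"
      by (rule partial_division_of_tagged_division[OF p])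
    have fin: "finite (snd ` p)" and finD: "finite D"
      using tagged_partial_division_ofD(1)[OF p] by (auto simp: D_def)
    have form: "{Inf K..Sup K} = K \<and> Inf K < Sup K \<and> {Inf K..Sup K} \<subseteq> {a..b}" if "K \<in> D" for K
    proof -
      obtain t where t: "(t, K) \<in> p" and i: "interior K \<noteq> {}"
        using \<open>K \<in> D\<close> by (auto simp: D_def)
      obtain u v where K: "K = {u..v}"
        using tagged_partial_division_ofD(4)[OF p t] by auto
      with i have "u < v" by (auto simp: K)
      then show ?thesis
        using tagged_partial_division_ofD(3)[OF p t] K by simp
    qed
    have inj: "inj_on (\<lambda>K. (Inf K, Sup K)) D"
    proof (rule inj_onI)
      fix K L assume "K \<in> D" "L \<in> D" "(Inf K, Sup K) = (Inf L, Sup L)"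
      then have "{Inf K..Sup K} = {Inf L..Sup L}" by simp
      then show "K = L"
        using form[OF \<open>K \<in> D\<close>] form[OF \<open>L \<in> D\<close>] by argo
    qed
    have disj: "interior K \<inter> interior L = {}" if "K \<in> D" "L \<in> D" "K \<noteq> L" for K L
      using that division_ofD(5)[OF div] by (auto simp: D_def)
    have int: "interior K = {Inf K<..<Sup K}" if "K \<in> D" for K
      using form[OF that] interior_atLeastAtMost_real[of "Inf K" "Sup K"] by argo
    have disj': "{Inf K<..<Sup K} \<inter> {Inf L<..<Sup L} = {}" if "K \<in> D" "L \<in> D" "K \<noteq> L" for K L
      using disj[OF that] int[OF that(1)] int[OF that(2)] by argo
    have "(\<Sum>(t, K)\<in>p. norm (x (Sup K) - x (Inf K)))
        = (\<Sum>K\<in>snd ` p. if interior K = {} then 0 else norm (x (Sup K) - x (Inf K)))"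
    proof -
      have "(\<Sum>(t, K)\<in>p. norm (x (Sup K) - x (Inf K)))
         = (\<Sum>(t, K)\<in>p. if interior K = {} then 0 else norm (x (Sup K) - x (Inf K)))"
      proof (rule sum.cong[OF refl], safe)
        fix t K assume t: "(t, K) \<in> p"
        obtain u v where K: "K = {u..v}" "u \<le> v"
          using tagged_partial_division_ofD(2)[OF p t] tagged_partial_division_ofD(4)[OF p t] by auto
        then show "norm (x (Sup K) - x (Inf K)) =
            (if interior K = {} then 0 else norm (x (Sup K) - x (Inf K)))"
          by auto
      qed
      \<comment> \<open>The \<open>if\<close> makes the summand vanish on intervals with empty
        interior, which is the condition for regrouping the sum by intervals instead of tagged
        intervals.\<close>
      also have "\<dots> = (\<Sum>K\<in>snd ` p. if interior K = {} then 0 else norm (x (Sup K) - x (Inf K)))"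
        by (rule sum.over_tagged_division_lemma[OF tagged_partial_division_of_Union_self[OF p]]) auto
      finally show ?thesis .
    qed
    also have "\<dots> = (\<Sum>K\<in>D. norm (x (Sup K) - x (Inf K)))"
      unfolding D_def by (rule sum.mono_neutral_cong_right) (use fin in auto)
    also have "\<dots> = (\<Sum>(u, v)\<in>P. norm (x v - x u))"
      unfolding P_def using inj by (simp add: sum.reindex)
    also have "\<dots> < \<epsilon>"
    proof (rule ac)
      show "finite P" using finD by (simp add: P_def)
      show "\<forall>(u, v)\<in>P. u \<le> v \<and> {u..v} \<subseteq> {a..b}"
        using form by (auto simp: P_def less_imp_le)
      show "pairwise (\<lambda>(u, v) (c, d). {u<..<v} \<inter> {c<..<d} = {}) P"
        unfolding P_def by (rule pairwise_imageI) (simp only: prod.case, rule disj')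
      have "(\<Sum>(u, v)\<in>P. v - u) = (\<Sum>K\<in>D. Sup K - Inf K)"
        unfolding P_def using inj by (simp add: sum.reindex)
      also have "\<dots> = (\<Sum>K\<in>D. measure lebesgue K)"
      proof (rule sum.cong[OF refl])
        fix K assume "K \<in> D"
        then have le: "Inf K \<le> Sup K" and eq: "{Inf K..Sup K} = K" using form by (auto simp: less_imp_le)
        from le have "measure lebesgue {Inf K..Sup K} = Sup K - Inf K" by simp
        then show "Sup K - Inf K = measure lebesgue K" unfolding eq by (rule sym)
      qed
      also have "\<dots> \<le> (\<Sum>K\<in>snd ` p. measure lebesgue K)"
        by (rule sum_mono2[OF fin]) (auto simp: D_def)
      also have "\<dots> = measure lebesgue (\<Union>(snd ` p))"
        by (rule content_division[OF div])
      finally show "(\<Sum>(u, v)\<in>P. v - u) < \<delta>" using m by simp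
    qed
    finally show ?thesis .
  qed
  with \<delta> show thesis by (rule that)
qed

text \<open>
  Tags outside \<open>N\<close> are controlled by differentiability; the intervals tagged in \<open>N\<close> lie in an open
  set of small measure, so absolute continuity bounds their total increment.
\<close>
theorem fundamental_theorem_of_calculus_abs_continuous:
  fixes x :: "real \<Rightarrow> 'a::banach"
  assumes ac: "abs_continuous_on {a..b} x" and "a \<le> b" and "negligible N"
    and der: "\<And>t. t \<in> {a..b} - N \<Longrightarrow> (x has_vector_derivative g t) (at t within {a..b})"
  shows "(g has_integral (x b - x a)) {a..b}"
proof -
  \<comment> \<open>\<open>g\<close> is arbitrary on \<open>N\<close>, so its values there are reset
    to \<open>0\<close>; a term tagged in \<open>N\<close> then consists of an increment of
    \<open>x\<close> alone.\<close>
  define g0 where "g0 t = (if t \<in> N then 0 else g t)" for t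
  have "(g0 has_integral (x b - x a)) {a..b}"
    unfolding has_integral_real
  proof (intro allI impI)
    fix e :: real assume "e > 0"
    \<comment> \<open>Half of \<open>e\<close> goes to each kind of tag; the \<open>+ 1\<close>
      keeps the divisor positive when \<open>a = b\<close>.\<close>
    define e1 where "e1 = e / (2 * (b - a + 1))"
    have e1: "e1 > 0" and e1_le: "e1 * (b - a) \<le> e / 2"
      using \<open>e > 0\<close> \<open>a \<le> b\<close> by (auto simp: e1_def field_simps)
    obtain \<delta> where \<delta>: "\<delta> > 0"
      and small: "\<And>p. p tagged_partial_division_of {a..b} \<Longrightarrow>
            measure lebesgue (\<Union>(snd ` p)) < \<delta> \<Longrightarrow>
            (\<Sum>(t, K)\<in>p. norm (x (Sup K) - x (Inf K))) < e / 2"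
      using abs_continuous_on_tagged_partial_division[OF ac, of "e / 2"] \<open>e > 0\<close> by auto
    obtain U where U: "open U" "N \<subseteq> U" "U \<in> lmeasurable" "measure lebesgue U < \<delta>"
    proof -
      have N: "N \<in> lmeasurable" "measure lebesgue N = 0"
        using \<open>negligible N\<close> negligible_iff_measure by auto
      then obtain U where U: "open U" "N \<subseteq> U" "U - N \<in> lmeasurable"
          "emeasure lebesgue (U - N) < ennreal \<delta>"
        using sets_lebesgue_outer_open[OF fmeasurableD[OF N(1)] \<delta>] by metis
      then have UN: "U = (U - N) \<union> N" by auto
      then have "U \<in> lmeasurable" using U N by (metis fmeasurable.Un)
      moreover have "measure lebesgue U = measure lebesgue (U - N)"
        by (metis N measurable_measure_Diff \<open>U \<in> lmeasurable\<close> U(2) diff_zero fmeasurableD)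
      moreover have "measure lebesgue (U - N) < \<delta>"
        using U(3,4) \<delta> by (simp add: emeasure_eq_measure2 ennreal_less_iff)
      ultimately show thesis using U that by metis
    qed
    have "\<exists>d>0. (t \<in> N \<longrightarrow> ball t d \<subseteq> U) \<and>
        (t \<in> {a..b} - N \<longrightarrow> (\<forall>y\<in>{a..b}. norm (y - t) < d \<longrightarrow>
             norm (x y - x t - (y - t) *\<^sub>R g t) \<le> e1 * norm (y - t)))" for t
    proof (cases "t \<in> N")
      case True
      then show ?thesis using U openE by (metis DiffD2 subsetD)
    next
      case False
      show ?thesis
      proof (cases "t \<in> {a..b}")
        case True
        have "\<exists>d>0. \<forall>y\<in>{a..b}. norm (y - t) < d \<longrightarrow>
             norm (x y - x t - (y - t) *\<^sub>R g t) \<le> e1 * norm (y - t)"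
          using der[of t] True False e1
          unfolding has_vector_derivative_def has_derivative_within_alt by blast
        then show ?thesis using False by auto
      qed (use False in \<open>auto intro: exI[of _ 1]\<close>)
    qed
    then obtain d where d: "\<And>t. d t > 0" "\<And>t. t \<in> N \<Longrightarrow> ball t (d t) \<subseteq> U"
      "\<And>t y. t \<in> {a..b} \<Longrightarrow> t \<notin> N \<Longrightarrow> y \<in> {a..b} \<Longrightarrow> norm (y - t) < d t \<Longrightarrow>
             norm (x y - x t - (y - t) *\<^sub>R g t) \<le> e1 * norm (y - t)"
      by (metis DiffI)
    show "\<exists>\<gamma>. gauge \<gamma> \<and> (\<forall>\<D>. \<D> tagged_division_of {a..b} \<and> \<gamma> fine \<D> \<longrightarrow>
        norm ((\<Sum>(t, K)\<in>\<D>. measure lborel K *\<^sub>R g0 t) - (x b - x a)) < e)"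
    proof (intro exI[of _ "\<lambda>t. ball t (d t)"] conjI allI impI)
      show "gauge (\<lambda>t. ball t (d t))" using d(1) by (rule gauge_ball_dependent[rule_format])
    next
      fix p assume "p tagged_division_of {a..b} \<and> (\<lambda>t. ball t (d t)) fine p"
      then have p: "p tagged_division_of {a..b}" and fine: "(\<lambda>t. ball t (d t)) fine p" by auto
      have finp: "finite p" using p by auto
      define q where "q = {(t, K) \<in> p. t \<in> N}"
      have qp: "q \<subseteq> p" by (auto simp: q_def)
      have ba: "(\<Sum>(t, K)\<in>p. Sup K - Inf K) = b - a"
          "(\<Sum>(t, K)\<in>p. x (Sup K) - x (Inf K)) = x b - x a"
        using additive_tagged_division_1[OF \<open>a \<le> b\<close> p, of "\<lambda>x. x"]
          additive_tagged_division_1[OF \<open>a \<le> b\<close> p, of x] by auto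
      have qpart: "q tagged_partial_division_of {a..b}"
        using p qp tagged_partial_division_subset tagged_division_of_def by metis
      have "\<Union>(snd ` q) \<subseteq> U"
        using fine d(2) by (fastforce simp: q_def fine_def)
      then have "measure lebesgue (\<Union>(snd ` q)) \<le> measure lebesgue U"
        using U lmeasurable_division[OF partial_division_of_tagged_division[OF qpart]]
        by (intro measure_mono_fmeasurable) (auto simp: fmeasurableD)
      then have q: "(\<Sum>(t, K)\<in>q. norm (x (Sup K) - x (Inf K))) < e / 2"
        using small[OF qpart] U(4) by simp
      have ge0: "0 \<le> Sup K - Inf K" if tK: "(t, K) \<in> p" for t K
      proof -
        obtain u v where "K = {u..v}" "u \<le> v"
          using tagged_division_ofD(2)[OF p tK] tagged_division_ofD(4)[OF p tK] by auto
        then show ?thesis by simp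
      qed
      have main: "norm (measure lborel K *\<^sub>R g0 t - (x (Sup K) - x (Inf K)))
          \<le> e1 * (Sup K - Inf K)" if tK: "(t, K) \<in> p - q" for t K
      proof -
        have tp: "(t, K) \<in> p" and tN: "t \<notin> N" using that by (auto simp: q_def)
        obtain u v where K: "K = {u..v}" "u \<le> v"
          using tagged_division_ofD(2)[OF p tp] tagged_division_ofD(4)[OF p tp] by auto
        have t: "t \<in> {u..v}" "{u..v} \<subseteq> {a..b}" using tagged_division_ofD(2,3)[OF p tp] K by auto
        have ball: "K \<subseteq> ball t (d t)" using fine tp by (auto simp: fine_def)
        have est: "norm (x y - x t - (y - t) *\<^sub>R g t) \<le> e1 * norm (y - t)" if "y \<in> {u..v}" for y
          using that d(3)[of t y] t tN ball K by (auto simp: dist_real_def abs_minus_commute subset_iff)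
        \<comment> \<open>The tag lies between \<open>u\<close> and \<open>v\<close>, so expanding
          at \<open>t\<close> towards both ends costs a multiple of
          \<open>|u - t| + |v - t| = v - u\<close>.\<close>
        have "norm ((v - u) *\<^sub>R g t - (x v - x u))
            = norm ((x u - x t - (u - t) *\<^sub>R g t) - (x v - x t - (v - t) *\<^sub>R g t))"
          by (auto simp: algebra_simps)
        also have "\<dots> \<le> e1 * norm (u - t) + e1 * norm (v - t)"
          using norm_triangle_ineq4 est[of u] est[of v] K by (smt (verit) atLeastAtMost_iff)
        also have "\<dots> = e1 * (v - u)" using t by (auto simp: algebra_simps)
        finally show ?thesis using K tN by (simp add: g0_def)
      qed
      have "norm ((\<Sum>(t, K)\<in>p. measure lborel K *\<^sub>R g0 t) - (x b - x a))
          = norm (\<Sum>(t, K)\<in>p. measure lborel K *\<^sub>R g0 t - (x (Sup K) - x (Inf K)))"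
        by (simp add: ba(2)[symmetric] split_def sum_subtractf)
      also have "\<dots> \<le> (\<Sum>(t, K)\<in>p. norm (measure lborel K *\<^sub>R g0 t - (x (Sup K) - x (Inf K))))"
        by (simp add: split_def norm_sum)
      also have "\<dots> = (\<Sum>(t, K)\<in>p - q. norm (measure lborel K *\<^sub>R g0 t - (x (Sup K) - x (Inf K))))
            + (\<Sum>(t, K)\<in>q. norm (measure lborel K *\<^sub>R g0 t - (x (Sup K) - x (Inf K))))"
        using finp qp by (rule sum.subset_diff[rotated])
      also have "(\<Sum>(t, K)\<in>q. norm (measure lborel K *\<^sub>R g0 t - (x (Sup K) - x (Inf K))))
            = (\<Sum>(t, K)\<in>q. norm (x (Sup K) - x (Inf K)))"
        by (rule sum.cong) (auto simp: q_def g0_def norm_minus_commute)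
      also have "(\<Sum>(t, K)\<in>p - q. norm (measure lborel K *\<^sub>R g0 t - (x (Sup K) - x (Inf K))))
          \<le> (\<Sum>(t, K)\<in>p - q. e1 * (Sup K - Inf K))"
        by (rule sum_mono) (use main in auto)
      also have "\<dots> \<le> (\<Sum>(t, K)\<in>p. e1 * (Sup K - Inf K))"
        by (rule sum_mono2) (use finp e1 ge0 in auto)
      also have "\<dots> = e1 * (b - a)"
        by (simp add: ba(1)[symmetric] sum_distrib_left split_def)
      also note e1_le
      finally show "norm ((\<Sum>(t, K)\<in>p. measure lborel K *\<^sub>R g0 t) - (x b - x a)) < e"
        using q by simp
    qed
  qed
  then show ?thesis
    by (rule has_integral_spike[OF \<open>negligible N\<close>, rotated]) (auto simp: g0_def)
qed


subsection \<open>Switching signals\<close>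

text \<open>Jumps near \<open>t\<close> are finitely many, so some open interval to the right of
  \<open>t\<close> contains none and the signal is constant there; right continuity forces that
  constant to be the value at \<open>t\<close>, even when \<open>t\<close> is itself a jump.\<close>

lemma switching_signal_eq_right:
  assumes "switching_signal \<sigma>"
  obtains \<epsilon> where "\<epsilon> > 0" and "\<And>u. t \<le> u \<Longrightarrow> u < t + \<epsilon> \<Longrightarrow> \<sigma> u = \<sigma> t"
proof -
  have fin: "finite (jumps \<sigma> \<inter> {t..t + 1} - {t})"
    using assms by (simp add: switching_signal_def)
  obtain d where d: "d > 0" "\<And>u. u \<in> jumps \<sigma> \<inter> {t..t + 1} - {t} \<Longrightarrow> d \<le> dist t u"
    using finite_set_avoid[OF fin, of t] by auto
  define \<epsilon> where "\<epsilon> = min d 1"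
  have \<epsilon>: "\<epsilon> > 0" using d by (simp add: \<epsilon>_def)
  have "jumps \<sigma> \<inter> {t<..<t + \<epsilon>} = {}"
    using d(2) by (fastforce simp: \<epsilon>_def dist_real_def)
  then obtain c where c: "\<And>u. u \<in> {t<..<t + \<epsilon>} \<Longrightarrow> \<sigma> u = c"
    using assms unfolding switching_signal_def constant_on_def by meson
  have "(\<sigma> \<longlongrightarrow> \<sigma> t) (at_right t)"
    using assms by (simp add: switching_signal_def continuous_within)
  moreover have "\<forall>\<^sub>F u in at_right t. \<sigma> u = c"
    using \<epsilon> c by (auto simp: eventually_at_right_field intro!: exI[of _ "t + \<epsilon>"])
  ultimately have "\<sigma> t = c"
    using tendsto_unique[of "at_right t" \<sigma> "\<sigma> t" c] tendsto_eventually by auto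
  then show thesis
    using \<epsilon> c by (intro that[of \<epsilon>]) (auto simp: less_le)
qed

lemma switching_signal_eq_nhds:
  assumes "switching_signal \<sigma>" and "t \<notin> jumps \<sigma>"
  obtains \<epsilon> where "\<epsilon> > 0" and "\<And>u. \<bar>u - t\<bar> < \<epsilon> \<Longrightarrow> \<sigma> u = \<sigma> t"
proof -
  have fin: "finite (jumps \<sigma> \<inter> {t - 1..t + 1})"
    using assms by (simp add: switching_signal_def)
  obtain d where d: "d > 0" "\<And>u. u \<in> jumps \<sigma> \<inter> {t - 1..t + 1} \<Longrightarrow> d \<le> dist t u"
    using finite_set_avoid[OF fin, of t] assms(2) by (metis IntD1)
  define \<epsilon> where "\<epsilon> = min d 1"
  have \<epsilon>: "\<epsilon> > 0" using d by (simp add: \<epsilon>_def)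
  have "jumps \<sigma> \<inter> {t - \<epsilon><..<t + \<epsilon>} = {}"
    using d(2) by (fastforce simp: \<epsilon>_def dist_real_def)
  then obtain c where c: "\<And>u. u \<in> {t - \<epsilon><..<t + \<epsilon>} \<Longrightarrow> \<sigma> u = c"
    using assms(1) unfolding switching_signal_def constant_on_def by meson
  show thesis
    using \<epsilon> c by (intro that[of \<epsilon>]) (auto simp: abs_less_iff)
qed

lemma negligible_jumps:
  assumes "switching_signal \<sigma>"
  shows "negligible (jumps \<sigma>)"
proof -
  have "jumps \<sigma> = (\<Union>n::nat. jumps \<sigma> \<inter> {- real n..real n})"
  proof (intro equalityI subsetI)
    fix t assume "t \<in> jumps \<sigma>"
    moreover obtain n :: nat where "\<bar>t\<bar> \<le> real n" using real_arch_simple by blast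
    ultimately show "t \<in> (\<Union>n::nat. jumps \<sigma> \<inter> {- real n..real n})"
      by (auto simp: abs_le_iff intro!: exI[of _ n])
  qed auto
  moreover have "negligible (\<Union>n::nat. jumps \<sigma> \<inter> {- real n..real n})"
    using assms by (intro negligible_countable_Union[of "range _", simplified])
      (auto simp: switching_signal_def intro: negligible_finite)
  ultimately show ?thesis by simp
qed

section \<open>From almost every time to every time\<close>

lemma AE_lebesgue_ex_greaterThanLessThan:
  fixes a b :: real
  assumes "AE u in lebesgue. P u" and "a < b"
  shows "\<exists>u\<in>{a<..<b}. P u"
proof (rule ccontr)
  assume none: "\<not> ?thesis"
  obtain N where "negligible N" "{u. \<not> P u} \<subseteq> N"
    using assms(1) eventually_ae_filter_negligible by blast
  then have "negligible (box a b)"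
    using none by (elim negligible_subset) auto
  then show False
    using \<open>a < b\<close> negligible_interval(2)[of a b] by (auto simp: box_eq_empty simp del: box_real)
qed

lemma AE_lebesgue_translation:
  fixes s :: real
  assumes "AE u in lebesgue. P u"
  shows "AE u in lebesgue. P (u + s)"
proof -
  obtain N where N: "negligible N" "{u. \<not> P u} \<subseteq> N"
    using assms eventually_ae_filter_negligible by blast
  have "{u. \<not> P (u + s)} \<subseteq> (+) (- s) ` N"
    using N(2) by (auto simp: image_iff intro!: bexI[of _ "_ + s"])
  then show ?thesis
    using negligible_translation[OF N(1)] eventually_ae_filter_negligible by blast
qed

text \<open>The signal is frozen just after \<open>t\<close>, and good times accumulate at
  \<open>t\<close> from the right; along them the pair converges to its value at \<open>t\<close>,
  and \<open>A\<close> is closed. Property P gives convergence almost everywhere only, and this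
  recovers statements at every time, jumps included.\<close>

lemma AE_mem_closed_switching:
  fixes x :: "real \<Rightarrow> 'a::metric_space"
  assumes "closed A" and "switching_signal \<sigma>" and "isCont x t"
    and ae: "AE u in lebesgue. (x u, \<sigma> u) \<in> A"
  shows "(x t, \<sigma> t) \<in> A"
proof -
  obtain \<epsilon> where \<epsilon>: "\<epsilon> > 0" "\<And>u. t \<le> u \<Longrightarrow> u < t + \<epsilon> \<Longrightarrow> \<sigma> u = \<sigma> t"
    by (rule switching_signal_eq_right[OF assms(2), of t]) blast
  \<comment> \<open>The chosen times shrink to \<open>t\<close> while staying inside the interval
    where the signal equals \<open>\<sigma> t\<close>.\<close>
  have "\<exists>u\<in>{t<..<t + \<epsilon> / real (Suc n)}. (x u, \<sigma> u) \<in> A" for n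
    using \<epsilon>(1) by (intro AE_lebesgue_ex_greaterThanLessThan[OF ae]) simp
  then obtain u where u: "\<And>n. u n \<in> {t<..<t + \<epsilon> / real (Suc n)}" "\<And>n. (x (u n), \<sigma> (u n)) \<in> A"
    by metis
  have to_t: "(\<lambda>n. t + \<epsilon> / real (Suc n)) \<longlonglongrightarrow> t + 0"
    by (intro tendsto_add tendsto_const LIMSEQ_Suc[OF lim_const_over_n])
  have le: "t \<le> u n" "u n \<le> t + \<epsilon> / real (Suc n)" for n
    using u(1)[of n] by auto
  have "u \<longlonglongrightarrow> t"
    by (rule tendsto_sandwich[OF always_eventually always_eventually tendsto_const to_t[simplified add_0_right]])
      (use le in blast)+
  then have "(\<lambda>n. x (u n)) \<longlonglongrightarrow> x t"
    by (rule isCont_tendsto_compose[OF assms(3)])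
  then have "(\<lambda>n. (x (u n), \<sigma> t)) \<longlonglongrightarrow> (x t, \<sigma> t)"
    by (intro tendsto_Pair tendsto_const)
  moreover have "(x (u n), \<sigma> t) \<in> A" for n
  proof -
    have "\<epsilon> / real (Suc n) \<le> \<epsilon>" using \<epsilon>(1) by (simp add: field_simps)
    then have "\<sigma> (u n) = \<sigma> t" using u(1)[of n] by (intro \<epsilon>(2)) auto
    then show ?thesis using u(2)[of n] by simp
  qed
  ultimately show ?thesis
    using closed_sequentially[OF \<open>closed A\<close>, of "\<lambda>n. (x (u n), \<sigma> t)"] by simp
qed

text \<open>Both signals are constant on a short interval to the right of \<open>t\<close>, and that
  interval contains a time at which they agree.\<close>

lemma switching_signal_eqI:
  assumes "switching_signal \<sigma>" and "switching_signal \<tau>" and ae: "AE u in lebesgue. \<sigma> u = \<tau> u"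
  shows "\<sigma> = \<tau>"
proof
  fix t
  obtain \<epsilon> where \<epsilon>: "\<epsilon> > 0" "\<And>u. t \<le> u \<Longrightarrow> u < t + \<epsilon> \<Longrightarrow> \<sigma> u = \<sigma> t"
    by (rule switching_signal_eq_right[OF assms(1), of t]) blast
  obtain \<epsilon>' where \<epsilon>': "\<epsilon>' > 0" "\<And>u. t \<le> u \<Longrightarrow> u < t + \<epsilon>' \<Longrightarrow> \<tau> u = \<tau> t"
    by (rule switching_signal_eq_right[OF assms(2), of t]) blast
  obtain u where "u \<in> {t<..<t + min \<epsilon> \<epsilon>'}" "\<sigma> u = \<tau> u"
    using AE_lebesgue_ex_greaterThanLessThan[OF ae, of t "t + min \<epsilon> \<epsilon>'"] \<epsilon>(1) \<epsilon>'(1) by auto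
  then show "\<sigma> t = \<tau> t"
    using \<epsilon>(2)[of u] \<epsilon>'(2)[of u] by auto
qed

lemma switching_signal_shift:
  assumes "switching_signal \<sigma>"
  shows "switching_signal (\<lambda>t. \<sigma> (t + s))"
proof -
  have jumps: "jumps (\<lambda>t. \<sigma> (t + s)) = (\<lambda>t. t - s) ` jumps \<sigma>"
  proof -
    have "isCont (\<lambda>t. \<sigma> (t + s)) t \<longleftrightarrow> isCont \<sigma> (t + s)" for t
      by (simp add: isCont_iff ac_simps)
    then show ?thesis
      by (auto simp: jumps_def image_iff) (metis add_diff_cancel)
  qed
  show ?thesis
    unfolding switching_signal_def
  proof (intro conjI allI impI)
    fix a b
    have "jumps (\<lambda>t. \<sigma> (t + s)) \<inter> {a..b} \<subseteq> (\<lambda>t. t - s) ` (jumps \<sigma> \<inter> {a + s..b + s})"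
      by (auto simp: jumps)
    then show "finite (jumps (\<lambda>t. \<sigma> (t + s)) \<inter> {a..b})"
      using assms by (auto simp: switching_signal_def elim: finite_subset)
  next
    fix a b assume "jumps (\<lambda>t. \<sigma> (t + s)) \<inter> {a<..<b} = {}"
    then have "jumps \<sigma> \<inter> {a + s<..<b + s} = {}"
      by (force simp: jumps)
    then have "\<sigma> constant_on {a + s<..<b + s}"
      using assms by (simp add: switching_signal_def)
    then show "(\<lambda>t. \<sigma> (t + s)) constant_on {a<..<b}"
      by (force simp: constant_on_def)
  next
    fix t
    have "(\<sigma> \<longlongrightarrow> \<sigma> (t + s)) (at_right (t + s))"
      using assms by (simp add: switching_signal_def continuous_within)
    then have "((\<lambda>t. \<sigma> (t + s)) \<longlongrightarrow> \<sigma> (t + s)) (at_right t)"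
      unfolding at_right_to_0[of t] at_right_to_0[of "t + s"] by (simp add: filterlim_filtermap add.assoc)
    then show "continuous (at_right t) (\<lambda>t. \<sigma> (t + s))"
      by (simp add: continuous_within)
  qed
qed

section \<open>Limits of signals under property P\<close>

lemma property_P_switching_signal:
  assumes "property_P S" and "\<sigma> \<in> S"
  shows "switching_signal \<sigma>"
  using assms unfolding property_P_def avg_dwell_def by auto

text \<open>Property P yields some limit in \<open>S\<close> along a subsequence; it agrees almost
  everywhere with \<tau>, hence everywhere by right continuity. This is what puts shifted limit
  signals back into \<open>S\<close>.\<close>

lemma property_P_limit_mem:
  assumes P: "property_P S" and "\<And>k. \<sigma>s k \<in> S" and "switching_signal \<tau>"
    and ae: "AE t in lebesgue. (\<lambda>k. \<sigma>s k t) \<longlonglongrightarrow> \<tau> t"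
  shows "\<tau> \<in> S"
proof -
  obtain \<sigma>' r where "\<sigma>' \<in> S" "strict_mono r"
    and ae': "AE t in lebesgue. (\<lambda>l. \<sigma>s (r l) t) \<longlonglongrightarrow> \<sigma>' t"
    using P assms(2) unfolding property_P_def by meson
  from ae ae' have "AE t in lebesgue. \<tau> t = \<sigma>' t"
  proof eventually_elim
    case (elim t)
    then have "(\<lambda>l. \<sigma>s (r l) t) \<longlonglongrightarrow> \<tau> t"
      using LIMSEQ_subseq_LIMSEQ[OF elim(1) \<open>strict_mono r\<close>] by (simp add: o_def)
    then show ?case using elim(2) LIMSEQ_unique by blast
  qed
  then have "\<tau> = \<sigma>'"
    using assms(3) property_P_switching_signal[OF P \<open>\<sigma>' \<in> S\<close>] by (intro switching_signal_eqI)
  then show ?thesis using \<open>\<sigma>' \<in> S\<close> by simp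
qed

section \<open>Monotone limits and gradients\<close>

lemma antimono_bounded_below_tendsto:
  fixes v :: "real \<Rightarrow> real"
  assumes "antimono_on {a..} v" and "bdd_below (v ` {a..})"
  shows "(v \<longlongrightarrow> Inf (v ` {a..})) at_top"
proof (rule order_tendstoI)
  fix y assume "y < Inf (v ` {a..})"
  then have "y < v t" if "t \<ge> a" for t
    using cInf_lower[OF imageI assms(2), of t] that by simp
  then show "\<forall>\<^sub>F t in at_top. y < v t"
    by (intro eventually_at_top_linorderI[of a])
next
  fix y assume "Inf (v ` {a..}) < y"
  then obtain t0 where "t0 \<ge> a" "v t0 < y"
    using cInf_less_iff[OF _ assms(2)] by auto
  then have "v t < y" if "t \<ge> t0" for t
    using monotone_onD[OF assms(1), of t0 t] that by auto
  then show "\<forall>\<^sub>F t in at_top. v t < y"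
    by (intro eventually_at_top_linorderI[of t0])
qed

text \<open>\<open>gradient\<close> is a definite description, so it has to be shown to denote: the
  adjoint of the derivative applied to \<open>1\<close> is a representing vector, and uniqueness of
  the derivative makes it the only one.\<close>

lemma GDERIV_gradient:
  fixes g :: "'a::euclidean_space \<Rightarrow> real"
  assumes "g differentiable (at \<xi>)"
  shows "GDERIV g \<xi> :> gradient g \<xi>"
proof -
  obtain g' where g': "(g has_derivative g') (at \<xi>)"
    using assms by (auto simp: differentiable_def)
  have "GDERIV g \<xi> :> adjoint g' 1"
    using g' adjoint_works[OF has_derivative_linear[OF g'], of _ 1] by (simp add: gderiv_def)
  moreover have "d = d'" if "GDERIV g \<xi> :> d" "GDERIV g \<xi> :> d'" for d d'
    using has_derivative_unique[OF that[unfolded gderiv_def]] by (metis inner_commute vector_eq_rdot)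
  ultimately show ?thesis
    unfolding gradient_def by (metis (mono_tags) theI)
qed

text \<open>The right derivative of the composition is \<open>0\<close> by constancy, and the
  gradient paired with \<open>w\<close> by the chain rule. Only a right derivative of
  \<open>x\<close> enters, so the argument also covers jump times.\<close>

lemma gradient_inner_eq_0_if_constant_right:
  fixes g :: "'a::euclidean_space \<Rightarrow> real"
  assumes "g differentiable (at (x t))" and "t < b"
    and x: "(x has_vector_derivative w) (at t within {t..b})"
    and const: "\<And>u. u \<in> {t..b} \<Longrightarrow> g (x u) = c"
  shows "gradient g (x t) \<bullet> w = 0"
proof -
  have "(g has_derivative (\<lambda>h. h \<bullet> gradient g (x t))) (at (x t))"
    using GDERIV_gradient[OF assms(1)] by (simp add: gderiv_def)
  then have "(g \<circ> x has_derivative (\<lambda>h. h \<bullet> gradient g (x t)) \<circ> (\<lambda>h. h *\<^sub>R w)) (at t within {t..b})"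
    using x unfolding has_vector_derivative_def
    by (intro diff_chain_within) (auto intro: has_derivative_at_withinI)
  then have "(g \<circ> x has_vector_derivative (w \<bullet> gradient g (x t))) (at t within {t..b})"
    by (simp add: has_vector_derivative_def o_def)
  moreover have "(g \<circ> x has_vector_derivative 0) (at t within {t..b})"
    by (rule has_vector_derivative_transform[where f = "\<lambda>_. c"]) (use \<open>t < b\<close> const in auto)
  ultimately show ?thesis
    using vector_derivative_unique_within_closed_interval[of t b t] \<open>t < b\<close>
    by (metis atLeastAtMost_iff inner_commute less_imp_le order_refl box_real(2))
qed


subsection \<open>Trajectories and their limits\<close>

text \<open>The integral form of the equation survives pointwise limits, unlike the differential
  one; absolute continuity is what allows the passage to it.\<close>

lemma trajectory_has_integral:
  assumes tr: "trajectory F f I x \<sigma>" and "{a..b} \<subseteq> I" and "a \<le> b"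
  shows "((\<lambda>t. f (x t, \<sigma> t)) has_integral (x b - x a)) {a..b}"
proof -
  obtain N where N: "negligible N"
      "{t. \<not> (t \<in> I \<longrightarrow> (x has_vector_derivative f (x t, \<sigma> t)) (at t within I))} \<subseteq> N"
    using tr unfolding trajectory_def eventually_ae_filter_negligible by blast
  show ?thesis
  proof (rule fundamental_theorem_of_calculus_abs_continuous[OF _ \<open>a \<le> b\<close> N(1)])
    show "abs_continuous_on {a..b} x"
      using tr \<open>{a..b} \<subseteq> I\<close> by (simp add: trajectory_def locally_abs_continuous_on_def)
    fix t assume "t \<in> {a..b} - N"
    then have "(x has_vector_derivative f (x t, \<sigma> t)) (at t within I)"
      using N(2) \<open>{a..b} \<subseteq> I\<close> by auto
    then show "(x has_vector_derivative f (x t, \<sigma> t)) (at t within {a..b})"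
      using \<open>{a..b} \<subseteq> I\<close> by (rule has_vector_derivative_within_subset)
  qed
qed

section \<open>Lipschitz curves and recovery of the differential equation\<close>

lemma lipschitz_imp_abs_continuous_on:
  fixes x :: "real \<Rightarrow> 'a::real_normed_vector"
  assumes "\<And>s t. norm (x t - x s) \<le> L * \<bar>t - s\<bar>"
  shows "abs_continuous_on A x"
  unfolding abs_continuous_on_def
proof (intro allI impI)
  fix \<epsilon> :: real assume "\<epsilon> > 0"
  have L: "L \<ge> 0" using order_trans[OF norm_ge_zero assms[of 1 0]] by simp
  \<comment> \<open>The constant \<open>L + 1\<close> is positive even for \<open>L = 0\<close>, so
    \<epsilon> can be divided by it.\<close>
  have "(\<Sum>(a, b)\<in>P. norm (x b - x a)) < \<epsilon>"
    if P: "finite P" "\<forall>(a, b)\<in>P. a \<le> b \<and> {a..b} \<subseteq> A" "(\<Sum>(a, b)\<in>P. b - a) < \<epsilon> / (L + 1)" for P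
  proof -
    have "(\<Sum>(a, b)\<in>P. norm (x b - x a)) \<le> (\<Sum>(a, b)\<in>P. (L + 1) * (b - a))"
    proof (rule sum_mono, safe)
      fix a b assume "(a, b) \<in> P"
      then have "a \<le> b" using P(2) by auto
      then show "norm (x b - x a) \<le> (L + 1) * (b - a)"
        using assms[of b a] by (simp add: algebra_simps)
    qed
    also have "\<dots> = (L + 1) * (\<Sum>(a, b)\<in>P. b - a)"
      by (simp add: sum_distrib_left split_def)
    also have "\<dots> < \<epsilon>" using P(3) L by (simp add: field_simps)
    finally show ?thesis .
  qed
  then show "\<exists>\<delta>>0. \<forall>P. finite P \<longrightarrow> (\<forall>(a, b)\<in>P. a \<le> b \<and> {a..b} \<subseteq> A) \<longrightarrow>
      pairwise (\<lambda>(a, b) (c, d). {a<..<b} \<inter> {c<..<d} = {}) P \<longrightarrow>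
      (\<Sum>(a, b)\<in>P. b - a) < \<delta> \<longrightarrow> (\<Sum>(a, b)\<in>P. norm (x b - x a)) < \<epsilon>"
    using \<open>\<epsilon> > 0\<close> L by (intro exI[of _ "\<epsilon> / (L + 1)"]) auto
qed

lemma lipschitz_imp_continuous_on:
  fixes x :: "real \<Rightarrow> 'a::real_normed_vector"
  assumes "\<And>s t. norm (x t - x s) \<le> L * \<bar>t - s\<bar>"
  shows "continuous_on A x"
proof -
  have "L \<ge> 0" using order_trans[OF norm_ge_zero assms[of 1 0]] by simp
  then have "L-lipschitz_on A x"
    using assms by (intro lipschitz_onI) (auto simp: dist_norm)
  then show ?thesis by (rule lipschitz_on_continuous_on)
qed

text \<open>With the signal frozen at \<gamma> the integrand is continuous, so the integral equation
  can be differentiated at every point of the interval, one-sidedly at its ends. Taking the left end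
  gives right derivatives at jump times.\<close>

lemma has_vector_derivative_if_signal_constant:
  fixes f :: "'a::banach \<times> 'g::metric_space \<Rightarrow> 'a"
  assumes "continuous_on F f" and x: "continuous_on {a..b} x"
    and F: "\<And>u. u \<in> {a..b} \<Longrightarrow> (x u, \<sigma> u) \<in> F"
    and int: "\<And>u. u \<in> {a..b} \<Longrightarrow> ((\<lambda>t. f (x t, \<sigma> t)) has_integral (x u - x a)) {a..u}"
    and const: "\<And>u. u \<in> {a..b} \<Longrightarrow> \<sigma> u = \<gamma>" and t: "t \<in> {a..b}"
  shows "(x has_vector_derivative f (x t, \<sigma> t)) (at t within {a..b})"
proof -
  let ?h = "\<lambda>u. f (x u, \<sigma> u)"
  have "continuous_on {a..b} (\<lambda>u. f (x u, \<gamma>))"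
    by (rule continuous_on_compose2[OF assms(1)])
      (use F const in \<open>force intro!: continuous_intros x\<close>)+
  then have "continuous_on {a..b} ?h"
    by (rule continuous_on_eq) (use const in auto)
  then have "((\<lambda>u. integral {a..u} ?h) has_vector_derivative ?h t) (at t within {a..b})"
    using t by (rule integral_has_vector_derivative)
  then have "((\<lambda>u. x a + integral {a..u} ?h) has_vector_derivative ?h t) (at t within {a..b})"
    by (auto intro!: derivative_eq_intros)
  then show ?thesis
    by (rule has_vector_derivative_transform[rotated 2]) (use t integral_unique[OF int] in auto)
qed

text \<open>Converse of \<open>trajectory_has_integral\<close> for Lipschitz curves: away from the
  jumps, a negligible set, the signal is locally constant and the integral equation can be
  differentiated.\<close>

lemma trajectoryI_integral:
  fixes F :: "((real^'n) \<times> 'g::metric_space) set"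
  assumes "continuous_on F f" and \<sigma>: "switching_signal \<sigma>"
    and lip: "\<And>s t. norm (x t - x s) \<le> L * \<bar>t - s\<bar>"
    and F: "\<And>t. (x t, \<sigma> t) \<in> F"
    and int: "\<And>a b. a \<le> b \<Longrightarrow> ((\<lambda>t. f (x t, \<sigma> t)) has_integral (x b - x a)) {a..b}"
  shows "trajectory F f UNIV x \<sigma>"
proof -
  have "AE t in lebesgue. t \<in> UNIV \<longrightarrow> (x has_vector_derivative f (x t, \<sigma> t)) (at t within UNIV)"
    unfolding eventually_ae_filter_negligible
  proof (intro exI[of _ "jumps \<sigma>"] conjI negligible_jumps[OF \<sigma>] subsetI CollectI)
    fix t assume "t \<in> {t. \<not> (t \<in> UNIV \<longrightarrow> (x has_vector_derivative f (x t, \<sigma> t)) (at t within UNIV))}"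
    then have not: "\<not> (x has_vector_derivative f (x t, \<sigma> t)) (at t)" by simp
    show "t \<in> jumps \<sigma>"
    proof (rule ccontr)
      assume "t \<notin> jumps \<sigma>"
      then obtain \<epsilon> where \<epsilon>: "\<epsilon> > 0" "\<And>u. \<bar>u - t\<bar> < \<epsilon> \<Longrightarrow> \<sigma> u = \<sigma> t"
        by (rule switching_signal_eq_nhds[OF \<sigma>, of t]) blast
      have "(x has_vector_derivative f (x t, \<sigma> t)) (at t within {t - \<epsilon> / 2..t + \<epsilon> / 2})"
      proof (rule has_vector_derivative_if_signal_constant[OF assms(1)])
        show "\<sigma> u = \<sigma> t" if "u \<in> {t - \<epsilon> / 2..t + \<epsilon> / 2}" for u
          using that \<epsilon>(1) by (intro \<epsilon>(2)) auto
      qed (use F int \<epsilon>(1) lipschitz_imp_continuous_on[OF lip] in auto)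
      then have "(x has_vector_derivative f (x t, \<sigma> t)) (at t)"
        using \<epsilon>(1) by (subst (asm) at_within_interior) auto
      with not show False by simp
    qed
  qed
  then show ?thesis
    using \<sigma> F lipschitz_imp_abs_continuous_on[OF lip]
    by (simp add: trajectory_def locally_abs_continuous_on_def)
qed

text \<open>Arzela-Ascoli in pointwise form: a diagonal argument gives convergence at the rationals,
  and the common Lipschitz constant carries the Cauchy property to every real time. Pointwise
  convergence is enough for dominated convergence.\<close>

lemma equi_lipschitz_convergent_subsequence:
  fixes x :: "nat \<Rightarrow> real \<Rightarrow> 'a::{banach,heine_borel}"
  assumes bd: "\<And>n t. norm (x n t) \<le> M" and lip: "\<And>n s t. norm (x n t - x n s) \<le> L * \<bar>t - s\<bar>"
  obtains r y where "strict_mono (r :: nat \<Rightarrow> nat)" and "\<And>t. (\<lambda>n. x (r n) t) \<longlonglongrightarrow> y t"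
    and "\<And>s t. norm (y t - y s) \<le> L * \<bar>t - s\<bar>"
proof -
  have L: "L \<ge> 0" using order_trans[OF norm_ge_zero lip[of 0 1 0]] by simp
  obtain r where r: "strict_mono (r :: nat \<Rightarrow> nat)" "\<And>q. q \<in> \<rat> \<Longrightarrow> \<exists>l. (\<lambda>n. x (r n) q) \<longlonglongrightarrow> l"
    by (rule function_convergent_subsequence[where f = x, OF countable_rat bd]) blast
  have "Cauchy (\<lambda>n. x (r n) t)" for t
  proof (rule metric_CauchyI)
    fix e :: real assume "e > 0"
    \<comment> \<open>Two thirds of \<open>e\<close> pay for moving between \<open>t\<close> and a
      rational \<open>q\<close> within \<open>d\<close>, one third for the sequence at
      \<open>q\<close>; \<open>L + 1\<close> avoids division by zero.\<close>
    define d where "d = e / (3 * (L + 1))"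
    have d: "d > 0" and Ld: "L * d \<le> e / 3"
      using \<open>e > 0\<close> L by (auto simp: d_def field_simps)
    obtain q where q: "q \<in> \<rat>" "t < q" "q < t + d"
      using Rats_dense_in_real[of t "t + d"] d by auto
    have near: "dist (x (r n) t) (x (r n) q) \<le> e / 3" for n
    proof -
      have "norm (x (r n) t - x (r n) q) \<le> L * \<bar>t - q\<bar>" by (rule lip)
      also have "\<dots> \<le> L * d" using q L by (intro mult_left_mono) auto
      finally show ?thesis using Ld by (simp add: dist_norm)
    qed
    obtain l where "(\<lambda>n. x (r n) q) \<longlonglongrightarrow> l" using r(2) q(1) by blast
    then have "Cauchy (\<lambda>n. x (r n) q)" by (rule LIMSEQ_imp_Cauchy)
    then obtain n0 where n0: "\<And>m n. m \<ge> n0 \<Longrightarrow> n \<ge> n0 \<Longrightarrow> dist (x (r m) q) (x (r n) q) < e / 3"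
      using \<open>e > 0\<close> metric_CauchyD[of "\<lambda>n. x (r n) q" "e / 3"] by auto
    show "\<exists>n0. \<forall>m\<ge>n0. \<forall>n\<ge>n0. dist (x (r m) t) (x (r n) t) < e"
    proof (intro exI[of _ n0] allI impI)
      fix m n assume "n0 \<le> m" "n0 \<le> n"
      then show "dist (x (r m) t) (x (r n) t) < e"
        using near[of m] near[of n] n0[of m n]
          dist_triangle[of "x (r m) t" "x (r n) t" "x (r m) q"]
          dist_triangle2[of "x (r m) q" "x (r n) t" "x (r n) q"]
        by (simp add: dist_commute)
    qed
  qed
  then obtain y where y: "\<And>t. (\<lambda>n. x (r n) t) \<longlonglongrightarrow> y t"
    unfolding Cauchy_convergent_iff convergent_def by metis
  have "norm (y t - y s) \<le> L * \<bar>t - s\<bar>" for s t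
    by (rule tendsto_upperbound[OF tendsto_norm[OF tendsto_diff[OF y[of t] y[of s]]]])
      (use lip in auto)
  with r(1) y show thesis by (rule that)
qed

text \<open>Since \<open>f\<close> is bounded on \<open>K\<close>, dominated convergence passes to
  the limit in the integral equation. The hypotheses concern half-lines and large indices because a
  translate is only known to solve the equation from some time on, and that time recedes to minus
  infinity.\<close>

lemma trajectory_limit:
  fixes F :: "((real^'n) \<times> 'g::metric_space) set"
  assumes f: "continuous_on F f" and K: "compact K" "K \<subseteq> F"
    and \<sigma>: "switching_signal \<sigma>"
    and x_lim: "\<And>t. (\<lambda>n. xs n t) \<longlonglongrightarrow> x t"
    and \<sigma>_lim: "AE t in lebesgue. (\<lambda>n. \<sigma>s n t) \<longlonglongrightarrow> \<sigma> t"
    and lip: "\<And>s t. norm (x t - x s) \<le> L * \<bar>t - s\<bar>"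
    and mem: "\<And>t. \<forall>\<^sub>F n in sequentially. \<forall>u\<ge>t. (xs n u, \<sigma>s n u) \<in> K"
    and int: "\<And>a. \<forall>\<^sub>F n in sequentially. \<forall>b\<ge>a.
        ((\<lambda>t. f (xs n t, \<sigma>s n t)) has_integral (xs n b - xs n a)) {a..b}"
  shows "trajectory F f UNIV x \<sigma>" and "\<And>t. (x t, \<sigma> t) \<in> K"
proof -
  have fK: "continuous_on K f" using f K(2) continuous_on_subset by blast
  obtain C where C: "\<And>p. p \<in> K \<Longrightarrow> norm (f p) \<le> C"
    using compact_imp_bounded[OF compact_continuous_image[OF fK K(1)]]
    unfolding bounded_iff by blast
  obtain N where N: "negligible N" "{t. \<not> (\<lambda>n. \<sigma>s n t) \<longlonglongrightarrow> \<sigma> t} \<subseteq> N"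
    using \<sigma>_lim unfolding eventually_ae_filter_negligible by blast
  have lim: "(\<lambda>n. (xs n t, \<sigma>s n t)) \<longlonglongrightarrow> (x t, \<sigma> t)" if "t \<notin> N" for t
    using that N(2) by (intro tendsto_intros x_lim) auto
  have memN: "(x t, \<sigma> t) \<in> K" if "t \<notin> N" for t
    using mem[of t] by (intro Lim_in_closed_set[OF compact_imp_closed[OF K(1)] _ _ lim[OF that]])
      (auto elim: eventually_mono)
  show mem_K: "(x t, \<sigma> t) \<in> K" for t
  proof (rule AE_mem_closed_switching[OF compact_imp_closed[OF K(1)] \<sigma>])
    show "isCont x t"
      using lipschitz_imp_continuous_on[OF lip, of UNIV] by (simp add: continuous_on_eq_continuous_at)
    show "AE u in lebesgue. (x u, \<sigma> u) \<in> K"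
      unfolding eventually_ae_filter_negligible using N(1) memN by blast
  qed
  show "trajectory F f UNIV x \<sigma>"
  proof (rule trajectoryI_integral[OF f \<sigma> lip])
    show "(x t, \<sigma> t) \<in> F" for t using mem_K K(2) by blast
    fix a b :: real assume "a \<le> b"
    obtain n0 where n0: "\<And>n u. n \<ge> n0 \<Longrightarrow> u \<ge> a \<Longrightarrow> (xs n u, \<sigma>s n u) \<in> K"
      and n0_int: "\<And>n. n \<ge> n0 \<Longrightarrow>
          ((\<lambda>t. f (xs n t, \<sigma>s n t)) has_integral (xs n b - xs n a)) {a..b}"
      using eventually_conj[OF mem[of a] int[of a]] \<open>a \<le> b\<close> unfolding eventually_sequentially by blast
    \<comment> \<open>Dropping the first \<open>n0\<close> terms puts the pairs into
      \<open>K\<close> on \<open>[a, b]\<close>, and the value \<open>0\<close> on \<open>N\<close>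
      makes the integrands converge at every point.\<close>
    define h where "h n t = (if t \<in> N then 0 else f (xs (n + n0) t, \<sigma>s (n + n0) t))" for n t
    define g where "g t = (if t \<in> N then 0 else f (x t, \<sigma> t))" for t
    have h_int: "(h n has_integral (xs (n + n0) b - xs (n + n0) a)) {a..b}" for n
      by (rule has_integral_spike[OF N(1) _ n0_int[of "n + n0"]]) (auto simp: h_def)
    have h_lim: "(\<lambda>n. h n t) \<longlonglongrightarrow> g t" if t: "t \<in> {a..b}" for t
    proof (cases "t \<in> N")
      case False
      have "(\<lambda>n. (xs (n + n0) t, \<sigma>s (n + n0) t)) \<longlonglongrightarrow> (x t, \<sigma> t)"
        using LIMSEQ_ignore_initial_segment[OF lim[OF False], of n0] .
      then have "(\<lambda>n. f (xs (n + n0) t, \<sigma>s (n + n0) t)) \<longlonglongrightarrow> f (x t, \<sigma> t)"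
        using t n0 by (intro continuous_on_tendsto_compose[OF fK _ mem_K]) auto
      then show ?thesis using False by (simp add: h_def g_def)
    qed (simp add: h_def g_def)
    have "C \<ge> 0" using C[OF mem_K[of a]] norm_ge_zero order_trans by blast
    then have bound: "norm (h n t) \<le> C" if "t \<in> {a..b}" for n t
      using that C[OF n0[of "n + n0" t]] by (simp add: h_def)
    note dom = dominated_convergence[of h "{a..b}" "\<lambda>_. C" g,
        OF has_integral_integrable[OF h_int] integrable_const_ivl bound h_lim]
    have "(\<lambda>n. xs (n + n0) b - xs (n + n0) a) \<longlonglongrightarrow> x b - x a"
      by (intro tendsto_intros LIMSEQ_ignore_initial_segment x_lim)
    then have "integral {a..b} g = x b - x a"
      using dom(2) LIMSEQ_unique unfolding integral_unique[OF h_int] by blast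
    then have "(g has_integral (x b - x a)) {a..b}"
      using dom(1) by (metis integrable_integral)
    then show "((\<lambda>t. f (x t, \<sigma> t)) has_integral (x b - x a)) {a..b}"
      by (rule has_integral_spike[OF N(1), rotated]) (auto simp: g_def)
  qed
qed

section \<open>Translates of a trajectory\<close>

lemma has_integral_translation:
  fixes g :: "real \<Rightarrow> 'a::real_normed_vector"
  assumes "(g has_integral i) {a + c..b + c}"
  shows "((\<lambda>t. g (t + c)) has_integral i) {a..b}"
  using has_integral_affinity'[of g i "a + c" "b + c" 1 c] assms by simp

lemma trajectory_shift:
  fixes F :: "((real^'n) \<times> 'g::metric_space) set"
  assumes "continuous_on F f" and tr: "trajectory F f UNIV x \<sigma>"
    and lip: "\<And>s t. norm (x t - x s) \<le> L * \<bar>t - s\<bar>"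
  shows "trajectory F f UNIV (\<lambda>t. x (t + s)) (\<lambda>t. \<sigma> (t + s))"
proof (rule trajectoryI_integral[OF assms(1)])
  show "switching_signal (\<lambda>t. \<sigma> (t + s))"
    using tr by (intro switching_signal_shift) (simp add: trajectory_def)
  show "norm (x (t + s) - x (u + s)) \<le> L * \<bar>t - u\<bar>" for u t
    using lip[of "t + s" "u + s"] by simp
  show "(x (t + s), \<sigma> (t + s)) \<in> F" for t
    using tr by (simp add: trajectory_def)
  fix a b :: real assume "a \<le> b"
  then show "((\<lambda>t. f (x (t + s), \<sigma> (t + s))) has_integral x (b + s) - x (a + s)) {a..b}"
    by (intro has_integral_translation[where g = "\<lambda>t. f (x t, \<sigma> t)"] trajectory_has_integral[OF tr]) auto
qed

text \<open>A bound for \<open>f\<close> on \<open>K\<close> is a common Lipschitz constant of the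
  translates, so a first subsequence makes the curves converge; property P applied along it supplies
  a second one for the signals. Every fixed time is eventually inside the domain of the translates,
  so the limit lives on the whole line.\<close>

lemma trajectory_translates_limit:
  fixes F :: "((real^'n) \<times> 'g::metric_space) set" and ts :: "nat \<Rightarrow> real"
  assumes f: "continuous_on F f" and P: "property_P S" and "\<sigma> \<in> S"
    and tr: "trajectory F f I x \<sigma>" and I: "{0..} \<subseteq> I"
    and K: "compact K" "K \<subseteq> F" and mem: "\<And>t. t \<in> I \<Longrightarrow> (x t, \<sigma> t) \<in> K"
    and ts: "filterlim ts at_top sequentially" "\<And>k. ts k > 0"
  obtains r y \<tau> L where "strict_mono (r :: nat \<Rightarrow> nat)"
    and "\<And>t. (\<lambda>l. x (t + ts (r l))) \<longlonglongrightarrow> y t"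
    and "AE t in lebesgue. (\<lambda>l. \<sigma> (t + ts (r l))) \<longlonglongrightarrow> \<tau> t"
    and "trajectory F f UNIV y \<tau>" and "\<And>t. (y t, \<tau> t) \<in> K"
    and "\<And>s t. norm (y t - y s) \<le> L * \<bar>t - s\<bar>"
    and "\<And>s. (\<lambda>t. \<tau> (t + s)) \<in> S"
proof -
  have fK: "continuous_on K f" using f K(2) continuous_on_subset by blast
  obtain L where L: "\<And>p. p \<in> K \<Longrightarrow> norm (f p) \<le> L"
    using compact_imp_bounded[OF compact_continuous_image[OF fK K(1)]]
    unfolding bounded_iff by blast
  have L0: "L \<ge> 0" using L[OF mem[of 0]] I norm_ge_zero order_trans by (metis atLeast_iff order_refl subsetD)
  have lip0: "norm (x b - x a) \<le> L * (b - a)" if "0 \<le> a" "a \<le> b" for a b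
  proof -
    have "{a..b} \<subseteq> I" using that I by auto
    then have "norm (x b - x a) \<le> L * measure lborel (cbox a b)"
      using trajectory_has_integral[OF tr _ that(2)] L mem
      by (intro has_integral_bound[OF L0]) (auto simp: subset_iff)
    then show ?thesis using that(2) by simp
  qed
  have lip0': "norm (x b - x a) \<le> L * \<bar>b - a\<bar>" if "0 \<le> a" "0 \<le> b" for a b
    using lip0[of a b] lip0[of b a] that by (cases "a \<le> b") (auto simp: norm_minus_commute)
  \<comment> \<open>\<open>I\<close> need not contain \<open>t + t\<^sub>k\<close>, hence the truncation at \<open>0\<close>.\<close>
  define xs where "xs k t = x (max 0 (t + ts k))" for k t
  have xs_lip: "norm (xs k t - xs k s) \<le> L * \<bar>t - s\<bar>" for k s t
  proof -
    let ?a = "max 0 (s + ts k)" and ?b = "max 0 (t + ts k)"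
    have "norm (x ?b - x ?a) \<le> L * \<bar>?b - ?a\<bar>"
      by (intro lip0') auto
    also have "\<dots> \<le> L * \<bar>t - s\<bar>" by (intro mult_left_mono L0) auto
    finally show ?thesis by (simp add: xs_def)
  qed
  have "bounded (fst ` K)"
    by (intro compact_imp_bounded compact_continuous_image continuous_intros K(1))
  then obtain M where M: "\<And>p. p \<in> K \<Longrightarrow> norm (fst p) \<le> M"
    unfolding bounded_iff by blast
  have xs_bound: "norm (xs k t) \<le> M" for k t
  proof -
    have "max 0 (t + ts k) \<in> I" using I by auto
    then show ?thesis using M[OF mem] by (simp add: xs_def)
  qed
  obtain r1 y where r1: "strict_mono (r1 :: nat \<Rightarrow> nat)"
    and y: "\<And>t. (\<lambda>n. xs (r1 n) t) \<longlonglongrightarrow> y t"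
    and y_lip: "\<And>s t. norm (y t - y s) \<le> L * \<bar>t - s\<bar>"
    by (rule equi_lipschitz_convergent_subsequence[of xs, OF xs_bound xs_lip]) blast
  have shift: "(\<lambda>t. \<sigma> (t + s)) \<in> S" if "s > 0" for s
    using P \<open>\<sigma> \<in> S\<close> that unfolding property_P_def by blast
  have "\<forall>k. (\<lambda>t. \<sigma> (t + ts (r1 k))) \<in> S" using shift ts(2) by blast
  then obtain \<tau> r2 where \<tau>: "\<tau> \<in> S" and r2: "strict_mono (r2 :: nat \<Rightarrow> nat)"
    and \<tau>_lim: "AE t in lebesgue. (\<lambda>l. \<sigma> (t + ts (r1 (r2 l)))) \<longlonglongrightarrow> \<tau> t"
    using P[unfolded property_P_def, THEN conjunct2, THEN conjunct2, rule_format,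
        of "\<lambda>k t. \<sigma> (t + ts (r1 k))"] by blast
  define r where "r = r1 \<circ> r2"
  have r: "strict_mono r" unfolding r_def by (intro strict_mono_o r1 r2)
  have sw: "switching_signal \<tau>" by (rule property_P_switching_signal[OF P \<tau>])
  have y_lim: "(\<lambda>n. xs (r n) t) \<longlonglongrightarrow> y t" for t
    using LIMSEQ_subseq_LIMSEQ[OF y[of t] r2] by (simp add: o_def r_def)
  have \<tau>_lim': "AE t in lebesgue. (\<lambda>l. \<sigma> (t + ts (r l))) \<longlonglongrightarrow> \<tau> t"
    using \<tau>_lim by (simp add: r_def)
  have tsr: "filterlim (\<lambda>n. ts (r n)) at_top sequentially"
    using filterlim_compose[OF ts(1) filterlim_subseq[OF r]] by (simp add: o_def)
  have ev: "\<forall>\<^sub>F n in sequentially. 0 \<le> s + ts (r n)" for s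
    using filterlim_at_top[THEN iffD1, OF tsr, rule_format, of "- s"]
    by eventually_elim simp
  have xs_eq: "xs k t = x (t + ts k)" if "0 \<le> t + ts k" for k t
    using that by (simp add: xs_def max_def)
  have mem': "\<forall>\<^sub>F n in sequentially. \<forall>u\<ge>t. (xs (r n) u, \<sigma> (u + ts (r n))) \<in> K" for t
    using ev[of t]
  proof eventually_elim
    case (elim n)
    show ?case
    proof (intro allI impI)
      fix u assume "t \<le> u"
      then have u: "0 \<le> u + ts (r n)" using elim by simp
      then have "u + ts (r n) \<in> I" using I by auto
      then show "(xs (r n) u, \<sigma> (u + ts (r n))) \<in> K" using mem xs_eq[OF u] by simp
    qed
  qed
  have int: "\<forall>\<^sub>F n in sequentially. \<forall>b\<ge>a.
      ((\<lambda>t. f (xs (r n) t, \<sigma> (t + ts (r n)))) has_integral (xs (r n) b - xs (r n) a)) {a..b}" for a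
    using ev[of a]
  proof eventually_elim
    case (elim n)
    show ?case
    proof (intro allI impI)
      fix b assume "a \<le> b"
      then have "{a + ts (r n)..b + ts (r n)} \<subseteq> I" "a + ts (r n) \<le> b + ts (r n)"
        using elim I by auto
      from has_integral_translation[OF trajectory_has_integral[OF tr this]]
      have "((\<lambda>t. f (x (t + ts (r n)), \<sigma> (t + ts (r n)))) has_integral (xs (r n) b - xs (r n) a)) {a..b}"
        using elim \<open>a \<le> b\<close> by (simp add: xs_eq)
      then show "((\<lambda>t. f (xs (r n) t, \<sigma> (t + ts (r n)))) has_integral (xs (r n) b - xs (r n) a)) {a..b}"
        by (rule has_integral_eq[rotated]) (use elim in \<open>simp add: xs_eq\<close>)
    qed
  qed
  note limit = trajectory_limit[OF f K sw y_lim \<tau>_lim' y_lip mem' int]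
  have x_lim: "(\<lambda>l. x (t + ts (r l))) \<longlonglongrightarrow> y t" for t
    by (rule Lim_transform_eventually[OF y_lim])
      (use ev[of t] in \<open>auto elim!: eventually_mono simp: xs_eq\<close>)
  \<comment> \<open>Property P only allows shifts by \<open>s > 0\<close>; for a limit signal any \<open>s\<close> works, since
    \<open>s + t\<^sub>k > 0\<close> for large \<open>k\<close>.\<close>
  have shift_\<tau>: "(\<lambda>t. \<tau> (t + s)) \<in> S" for s
  proof -
    have "\<forall>\<^sub>F n in sequentially. 0 < s + ts (r n)"
      using filterlim_at_top_dense[THEN iffD1, OF tsr, rule_format, of "- s"]
      by eventually_elim simp
    then obtain k0 where k0: "\<And>k. k \<ge> k0 \<Longrightarrow> 0 < s + ts (r k)"
      unfolding eventually_sequentially by blast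
    show ?thesis
    proof (rule property_P_limit_mem[OF P])
      show "(\<lambda>t. \<sigma> (t + (s + ts (r (k + k0))))) \<in> S" for k
        by (rule shift[OF k0]) simp
      show "switching_signal (\<lambda>t. \<tau> (t + s))" by (rule switching_signal_shift[OF sw])
      show "AE t in lebesgue. (\<lambda>k. \<sigma> (t + (s + ts (r (k + k0))))) \<longlonglongrightarrow> \<tau> (t + s)"
        using AE_lebesgue_translation[OF \<tau>_lim', of s]
      proof eventually_elim
        case (elim t)
        then show ?case
          using LIMSEQ_ignore_initial_segment[OF elim, of k0] by (simp add: add.assoc)
      qed
    qed
  qed
  show thesis
    by (rule that[OF r x_lim \<tau>_lim' limit y_lip shift_\<tau>])
qed

text \<open>A union of weakly invariant sets is weakly invariant, since a witnessing trajectory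
  stays in the member it starts from. The union of all those inside \<open>E\<close> is thus the
  greatest one, hence the only maximal one; \<open>N0\<close> makes it nonempty.\<close>

lemma maximal_weakly_invariant_in_iff:
  assumes "weakly_invariant T N0" and "N0 \<subseteq> E"
  shows "maximal_weakly_invariant_in T E N \<longleftrightarrow> N = \<Union>{N. weakly_invariant T N \<and> N \<subseteq> E}"
proof -
  let ?M = "\<Union>{N. weakly_invariant T N \<and> N \<subseteq> E}"
  have "weakly_invariant T ?M"
    unfolding weakly_invariant_def[of T ?M]
  proof (intro conjI ballI)
    show "?M \<noteq> {}" using assms by (auto simp: weakly_invariant_def)
  next
    fix p assume "p \<in> ?M"
    then obtain N where N: "weakly_invariant T N" "N \<subseteq> E" "p \<in> N" by blast
    then obtain x \<sigma> where "(x, \<sigma>) \<in> T" "(x 0, \<sigma> 0) = p" "\<forall>t. (x t, \<sigma> t) \<in> N"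
      unfolding weakly_invariant_def by fast
    then show "case p of (\<xi>, \<gamma>) \<Rightarrow> \<exists>(x, \<sigma>)\<in>T. x 0 = \<xi> \<and> \<sigma> 0 = \<gamma> \<and> (\<forall>t. (x t, \<sigma> t) \<in> ?M)"
      using N by (auto intro!: bexI[of _ "(x, \<sigma>)"])
  qed
  then show ?thesis
    unfolding maximal_weakly_invariant_in_def by blast
qed


subsection \<open>The invariance principle\<close>

text \<open>Just after \<open>t\<close> the signal keeps the value \<open>\<tau> t\<close>, so
  \<open>y\<close> has a right derivative given by \<open>f\<close>, and \<open>V\<close> with its
  second argument held at \<open>\<tau> t\<close> equals \<open>c\<close> along \<open>y\<close>.
  Differentiating from the right gives the vanishing inner product.\<close>

lemma limit_trajectory_mem_level_Z_set:
  fixes F :: "((real^'n) \<times> 'g::metric_space) set"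
  assumes f: "continuous_on F f" and V: "class_V F W V"
    and tr: "trajectory F f UNIV y \<tau>" and y: "\<And>t. y t \<in> fst ` W" "continuous_on UNIV y"
    and c: "\<And>t. V (y t, \<tau> t) = c"
  shows "(y t, \<tau> t) \<in> {p \<in> W. V p = c} \<inter> Z_set F f W V"
proof -
  have F: "(y u, \<tau> u) \<in> F" for u using tr by (simp add: trajectory_def)
  then have fib: "y t \<in> fst ` W \<inter> fibre F (\<tau> t)" using y(1) by (simp add: fibre_def)
  then have W: "(y t, \<tau> t) \<in> W"
    using V unfolding class_V_def fibre_def by blast
  have diff: "(\<lambda>\<eta>. V (\<eta>, \<tau> t)) differentiable (at (y t))"
    using V fib unfolding class_V_def by blast
  have "switching_signal \<tau>" using tr by (simp add: trajectory_def)
  then obtain \<epsilon> where \<epsilon>: "\<epsilon> > 0" "\<And>u. t \<le> u \<Longrightarrow> u < t + \<epsilon> \<Longrightarrow> \<tau> u = \<tau> t"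
    by (rule switching_signal_eq_right[of \<tau> t]) blast
  have const: "\<tau> u = \<tau> t" if "u \<in> {t..t + \<epsilon> / 2}" for u
    using that \<epsilon>(1) by (intro \<epsilon>(2)) auto
  have "(y has_vector_derivative f (y t, \<tau> t)) (at t within {t..t + \<epsilon> / 2})"
    by (rule has_vector_derivative_if_signal_constant[OF f _ F _ const])
      (use \<epsilon>(1) continuous_on_subset[OF y(2)] trajectory_has_integral[OF tr] in auto)
  then have "gradient (\<lambda>\<eta>. V (\<eta>, \<tau> t)) (y t) \<bullet> f (y t, \<tau> t) = 0"
  proof (rule gradient_inner_eq_0_if_constant_right[where x = y and t = t and g = "\<lambda>\<eta>. V (\<eta>, \<tau> t)", OF diff, rotated])
    show "V (y u, \<tau> t) = c" if "u \<in> {t..t + \<epsilon> / 2}" for u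
      using c[of u] const[OF that] by simp
  qed (use \<epsilon>(1) in simp)
  then show ?thesis
    using W F y(1) c by (simp add: Z_set_def)
qed

theorem theorem3p2:
  fixes F :: "((real^'n) \<times> 'g::metric_space) set"
    and f :: "(real^'n) \<times> 'g \<Rightarrow> real^'n"
    and S :: "(real \<Rightarrow> 'g) set"
    and I :: "real set"
    and x :: "real \<Rightarrow> real^'n"
    and \<sigma> :: "real \<Rightarrow> 'g"
    and W :: "((real^'n) \<times> 'g) set"
    and V :: "(real^'n) \<times> 'g \<Rightarrow> real"
  assumes "compact (UNIV :: 'g set)"
    and "closed F"
    and "continuous_on F f"
    and "property_P S"
    and "\<sigma> \<in> S"
    and "forward_complete F f I x \<sigma>"
    and "class_V F W V"
    and "continuous_on (F \<inter> (fst ` W \<times> UNIV)) V"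
    and "precompact_rel (fst ` W) I x"
    and "antimono_on {0..} (\<lambda>t. V (x t, \<sigma> t))"
  shows "\<exists>c M.
    (\<forall>N. maximal_weakly_invariant_in (complete_trajectories F f S)
            ({p \<in> W. V p = c} \<inter> Z_set F f W V) N \<longleftrightarrow> N = M) \<and>
    ((\<lambda>t. infdist (x t) (fst ` M)) \<longlongrightarrow> 0) at_top"
proof -
  let ?T = "complete_trajectories F f S"
  let ?v = "\<lambda>t. V (x t, \<sigma> t)"
  have tr: "trajectory F f I x \<sigma>" and I: "{0..} \<subseteq> I"
    using assms(6) by (auto simp: forward_complete_def)
  obtain B where B: "compact B" "B \<subseteq> fst ` W" "\<And>t. t \<in> I \<Longrightarrow> x t \<in> B"
    using assms(9) by (auto simp: precompact_rel_def)
  \<comment> \<open>A compact set that carries the whole trajectory and on which both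
    \<open>f\<close> and \<open>V\<close> are continuous.\<close>
  define K where "K = F \<inter> (B \<times> UNIV)"
  have K: "compact K" "K \<subseteq> F"
    unfolding K_def using assms(1,2) B(1) by (auto intro: closed_Int_compact compact_Times)
  have VK: "continuous_on K V"
    by (rule continuous_on_subset[OF assms(8)]) (use B(2) in \<open>auto simp: K_def\<close>)
  have mem: "(x t, \<sigma> t) \<in> K" if "t \<in> I" for t
    using that B(3) tr by (simp add: K_def trajectory_def)
  obtain c where c: "(?v \<longlongrightarrow> c) at_top"
  proof
    have "bounded (V ` K)"
      by (intro compact_imp_bounded compact_continuous_image VK K)
    then have "bdd_below (V ` K)" by (rule bounded_imp_bdd_below)
    then have "bdd_below (?v ` {0..})"
      by (rule bdd_below_mono) (use mem I in auto)
    then show "(?v \<longlongrightarrow> Inf (?v ` {0..})) at_top"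
      by (rule antimono_bounded_below_tendsto[OF assms(10)])
  qed
  define E where "E = {p \<in> W. V p = c} \<inter> Z_set F f W V"
  define M where "M = \<Union>{N. weakly_invariant ?T N \<and> N \<subseteq> E}"

  \<comment> \<open>Stated for an arbitrary sequence of times: it serves once to show that
    \<open>E\<close> has a weakly invariant subset at all, and once to refute a sequence staying
    away from the projection of \<open>M\<close>.\<close>
  have limit_point: "\<exists>r \<xi> N. strict_mono (r :: nat \<Rightarrow> nat) \<and> (\<lambda>l. x (ts (r l))) \<longlonglongrightarrow> \<xi> \<and>
      \<xi> \<in> fst ` N \<and> weakly_invariant ?T N \<and> N \<subseteq> E"
    if ts: "filterlim ts at_top sequentially" "\<And>k. ts k > 0" for ts :: "nat \<Rightarrow> real"
  proof -
    obtain r y \<tau> L where r: "strict_mono (r :: nat \<Rightarrow> nat)"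
      and y_lim: "\<And>t. (\<lambda>l. x (t + ts (r l))) \<longlonglongrightarrow> y t"
      and \<tau>_lim: "AE t in lebesgue. (\<lambda>l. \<sigma> (t + ts (r l))) \<longlonglongrightarrow> \<tau> t"
      and y_tr: "trajectory F f UNIV y \<tau>" and y_mem: "\<And>t. (y t, \<tau> t) \<in> K"
      and lip: "\<And>s t. norm (y t - y s) \<le> L * \<bar>t - s\<bar>"
      and \<tau>: "\<And>s. (\<lambda>t. \<tau> (t + s)) \<in> S"
      by (rule trajectory_translates_limit[OF assms(3-5) tr I K _ ts]) (erule mem, rule that)
    have y_cont: "continuous_on UNIV y" by (rule lipschitz_imp_continuous_on[OF lip])
    have tsr: "filterlim (\<lambda>l. t + ts (r l)) at_top sequentially" for t
      using filterlim_compose[OF ts(1) filterlim_subseq[OF r]]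
      by (intro filterlim_tendsto_add_at_top[OF tendsto_const]) (simp add: o_def)
    have V_c: "V (y t, \<tau> t) = c" for t
    proof -
      \<comment> \<open>The level set is closed in \<open>K\<close>, so the identity
        \<open>V = c\<close> needs checking only at almost every time, where the signals
        converge.\<close>
      have "(y t, \<tau> t) \<in> {p \<in> K. V p = c}"
      proof (rule AE_mem_closed_switching)
        show "closed {p \<in> K. V p = c}"
          by (rule continuous_closed_preimage_constant[OF VK compact_imp_closed[OF K(1)]])
        show "switching_signal \<tau>" using y_tr by (simp add: trajectory_def)
        show "isCont y t" using y_cont by (simp add: continuous_on_eq_continuous_at)
        show "AE u in lebesgue. (y u, \<tau> u) \<in> {p \<in> K. V p = c}"
          using \<tau>_lim
        proof eventually_elim
          case (elim u)
          have "\<forall>\<^sub>F l in sequentially. 0 \<le> u + ts (r l)"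
            using tsr[of u] by (simp add: filterlim_at_top)
          then have "\<forall>\<^sub>F l in sequentially. (x (u + ts (r l)), \<sigma> (u + ts (r l))) \<in> K"
            by (rule eventually_mono) (use mem I in auto)
          then have "(\<lambda>l. ?v (u + ts (r l))) \<longlonglongrightarrow> V (y u, \<tau> u)"
            by (intro continuous_on_tendsto_compose[OF VK tendsto_Pair[OF y_lim elim] y_mem])
          moreover have "(\<lambda>l. ?v (u + ts (r l))) \<longlonglongrightarrow> c"
            by (rule filterlim_compose[OF c tsr])
          ultimately show ?case using y_mem LIMSEQ_unique by blast
        qed
      qed
      then show ?thesis by simp
    qed
    \<comment> \<open>The orbit of the limit pair. For its point with parameter \<open>s\<close> the
      witness is the pair shifted by \<open>s\<close>, which may be negative.\<close>
    define N where "N = range (\<lambda>s. (y s, \<tau> s))"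
    have "N \<subseteq> E"
      using limit_trajectory_mem_level_Z_set[OF assms(3,7) y_tr _ y_cont V_c] y_mem B(2)
      by (auto simp: N_def E_def K_def)
    moreover have "weakly_invariant ?T N"
      unfolding weakly_invariant_def
    proof (intro conjI ballI)
      fix p assume "p \<in> N"
      then obtain s where p: "p = (y s, \<tau> s)" by (auto simp: N_def)
      have "((\<lambda>t. y (t + s)), (\<lambda>t. \<tau> (t + s))) \<in> ?T"
        using trajectory_shift[OF assms(3) y_tr lip] \<tau> by (simp add: complete_trajectories_def)
      then show "case p of (\<xi>, \<gamma>) \<Rightarrow> \<exists>(x, \<sigma>)\<in>?T. x 0 = \<xi> \<and> \<sigma> 0 = \<gamma> \<and> (\<forall>t. (x t, \<sigma> t) \<in> N)"
        unfolding p by (auto simp: N_def intro!: bexI[of _ "((\<lambda>t. y (t + s)), (\<lambda>t. \<tau> (t + s)))"])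
    qed (simp add: N_def)
    moreover have "y 0 \<in> fst ` N" by (force simp: N_def)
    moreover have "(\<lambda>l. x (ts (r l))) \<longlonglongrightarrow> y 0" using y_lim[of 0] by simp
    ultimately show ?thesis using r by blast
  qed

  obtain N0 where N0: "weakly_invariant ?T N0" "N0 \<subseteq> E"
  proof -
    \<comment> \<open>Any sequence of positive times tending to infinity would do;
      \<open>Suc\<close> excludes the time \<open>0\<close>, as property P shifts signals by
      \<open>s > 0\<close> only.\<close>
    have "filterlim (\<lambda>k. real (Suc k)) at_top sequentially"
      by (rule filterlim_compose[OF filterlim_real_sequentially filterlim_Suc])
    then show thesis using limit_point[of "\<lambda>k. real (Suc k)"] that by auto
  qed
  have "((\<lambda>t. infdist (x t) (fst ` M)) \<longlongrightarrow> 0) at_top"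
  proof (rule ccontr)
    assume "\<not> ?thesis"
    then obtain e where e: "e > 0" "\<not> (\<forall>\<^sub>F t in at_top. infdist (x t) (fst ` M) < e)"
      by (auto simp: tendsto_iff dist_real_def infdist_nonneg)
    \<comment> \<open>Failure of convergence gives, beyond every \<open>k\<close>, a time at
      distance at least \<open>e\<close> from the projection of \<open>M\<close>. A limit point of
      \<open>x\<close> along these times lies in that projection, while continuity of the distance
      keeps it at least \<open>e\<close> away.\<close>
    then have "\<exists>t. t > real k \<and> e \<le> infdist (x t) (fst ` M)" for k
      unfolding eventually_at_top_dense by (metis not_less)
    then obtain ts where ts: "\<And>k. ts k > real k" "\<And>k. e \<le> infdist (x (ts k)) (fst ` M)"
      by metis
    have "filterlim ts at_top sequentially"
      by (rule filterlim_at_top_mono[OF filterlim_real_sequentially])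
        (use ts(1) in \<open>auto intro: always_eventually less_imp_le\<close>)
    moreover have "ts k > 0" for k using ts(1)[of k] by simp
    ultimately obtain r \<xi> N where r: "(\<lambda>l. x (ts (r l))) \<longlonglongrightarrow> \<xi>" "\<xi> \<in> fst ` N"
        "weakly_invariant ?T N" "N \<subseteq> E"
      using limit_point by blast
    then have "\<xi> \<in> fst ` M" unfolding M_def by blast
    have "(\<lambda>l. infdist (x (ts (r l))) (fst ` M)) \<longlonglongrightarrow> infdist \<xi> (fst ` M)"
      by (rule tendsto_infdist[OF r(1)])
    then have "e \<le> infdist \<xi> (fst ` M)"
      by (rule LIMSEQ_le_const) (use ts(2) in auto)
    then show False using \<open>\<xi> \<in> fst ` M\<close> e(1) by simp
  qed
  then show ?thesis
    using maximal_weakly_invariant_in_iff[OF N0] unfolding E_def M_def by blast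
qed

end
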